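(* Consider an autonomous system on $\mathcal X\subset\mathbb R^{n+m}$, with $n\ge2$ and $m\ge1$, which is a skew-symmetric feedback interconnection of a system $a$ (state dimension $n$) and a system $b$ (state dimension $m$), i.e. its Jacobian has the form $$J^{ab}(x)=\begin{bmatrix}J^a(x) & G(x)\\ -G(x)' & J^b(x)\end{bmatrix},\qquad x\in\mathcal X,$$ where $J^a(x)\in\mathbb R^{n\times n}$ and $J^b(x)\in\mathbb R^{m\times m}$ are the Jacobians of systems $a$ and $b$, and $G(x)\in\mathbb R^{n\times m}$ is arbitrary. Write $J_s^a,J_s^b$ for the symmetric parts of $J^a,J^b$, and $\lambda_i^a(x)=\lambda_i(J_s^a(x))$, $\lambda_i^b(x)=\lambda_i(J_s^b(x))$. Assume that system $a$ is weakly contracting, i.e. $\lambda_1^a(x)+\lambda_2^a(x)<0$ for all $x\in\mathcal X$, and that system $b$ is contracting, i.e. $\lambda_1^b(x)<0$ for all $x\in\mathcal X$. If $\lambda_1^a(x)+\lambda_1^b(x)<0$ for all $x\in\mathcal X$, then the feedback interconnection is weakly contracting, i.e. $$\lambda_1(J_s^{ab}(x))+\lambda_2(J_s^{ab}(x))<0\quad\text{for all }x\in\mathcal X,$$ where $J_s^{ab}$ is the symmetric part of $J^{ab}$.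
   Context: Primes denote transpose; the symmetric part of a square matrix $J$ is $J_s=\tfrac12(J+J')$. For a symmetric matrix $H$, $\lambda_1(H)\ge\lambda_2(H)\ge\cdots$ denote its eigenvalues in non-increasing order, counted with multiplicity. Systems are considered on a compact, simply-connected, strictly forward-invariant set $\mathcal X$ (any solution starting on the boundary of $\mathcal X$ at $t=0$ remains in the interior of $\mathcal X$ afterwards); it is assumed that the interconnected system does not leave the set $\mathcal X$ on which the stated conditions hold. A system with Jacobian $J$ is weakly contracting if $\lambda_1(J_s(x))+\lambda_2(J_s(x))<0$ for all $x$, and contracting (in the identity metric) if $\lambda_1(J_s(x))<0$ for all $x$. *)

theory Defs
  imports "HOL-Analysis.Analysis" "HOL-Computational_Algebra.Polynomial"
begin

definition sym_part :: "real^'k^'k \<Rightarrow> real^'k^'k" where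
  "sym_part J = (1/2) *\<^sub>R (J + transpose J)"

definition charpoly :: "real^'k^'k \<Rightarrow> real poly" where
  "charpoly H = det (\<chi> i j. (if i = j then [:0, 1:] else 0) - [:H $ i $ j:])"

text \<open>
  The \<open>i\<close>-th largest eigenvalue, counted with multiplicity and indexed from 1. It is meaningful for
  symmetric \<open>H\<close> (so that all roots of the characteristic polynomial are real) and
  \<open>1 \<le> i \<le> CARD('k)\<close>.
\<close>
definition eigval :: "nat \<Rightarrow> real^'k^'k \<Rightarrow> real" where
  "eigval i H = rev (sorted_list_of_multiset (proots (charpoly H))) ! (i - 1)"

definition weakly_contracting_on :: "'s set \<Rightarrow> ('s \<Rightarrow> real^'k^'k) \<Rightarrow> bool" where
  "weakly_contracting_on X J \<longleftrightarrow>
     (\<forall>x\<in>X. eigval 1 (sym_part (J x)) + eigval 2 (sym_part (J x)) < 0)"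

definition contracting_on :: "'s set \<Rightarrow> ('s \<Rightarrow> real^'k^'k) \<Rightarrow> bool" where
  "contracting_on X J \<longleftrightarrow> (\<forall>x\<in>X. eigval 1 (sym_part (J x)) < 0)"

text \<open>
  The dimension of the joint state is \<open>CARD('n) + CARD('m)\<close>: its index type is the sum type
  \<open>'n + 'm\<close>, the components tagged \<^const>\<open>Inl\<close> forming the state of the first system.
\<close>
definition state_a :: "real^('n::finite + 'm::finite) \<Rightarrow> real^'n" where
  "state_a x = (\<chi> i. x $ Inl i)"

definition state_b :: "real^('n::finite + 'm::finite) \<Rightarrow> real^'m" where
  "state_b x = (\<chi> j. x $ Inr j)"

definition block_matrix ::
  "real^'n^'n \<Rightarrow> real^'m^'n \<Rightarrow> real^'n^'m \<Rightarrow> real^'m^'m \<Rightarrow> real^('n::finite + 'm::finite)^('n + 'm)" where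
  "block_matrix A B C D = (\<chi> r c.
     case r of
       Inl i \<Rightarrow> (case c of Inl k \<Rightarrow> A $ i $ k | Inr l \<Rightarrow> B $ i $ l)
     | Inr j \<Rightarrow> (case c of Inl k \<Rightarrow> C $ j $ k | Inr l \<Rightarrow> D $ j $ l))"

text \<open>
  The two systems are \<open>y' = fa y z\<close> and \<open>z' = fb z y\<close>: each vector field takes its own state first and
  the state of the other system, as input, second. Every vector field on the joint state space
  is of the form \<open>interconnection fa fb\<close>.
\<close>
definition interconnection ::
  "(real^'n \<Rightarrow> real^'m \<Rightarrow> real^'n) \<Rightarrow> (real^'m \<Rightarrow> real^'n \<Rightarrow> real^'m)
    \<Rightarrow> real^('n::finite + 'm::finite) \<Rightarrow> real^('n::finite + 'm::finite)" where
  "interconnection fa fb x = (\<chi> r.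
     case r of
       Inl i \<Rightarrow> fa (state_a x) (state_b x) $ i
     | Inr j \<Rightarrow> fb (state_b x) (state_a x) $ j)"

text \<open>Jacobian of a system with respect to its own state \<open>y\<close>, at input \<open>u\<close>.\<close>
definition state_jacobian ::
  "(real^'k \<Rightarrow> 'u \<Rightarrow> real^'k) \<Rightarrow> real^'k \<Rightarrow> 'u \<Rightarrow> real^'k^'k" where
  "state_jacobian g y u = jacobian (\<lambda>v. g v u) (at y)"

text \<open>Solutions on \<open>[0, T)\<close> of the autonomous system \<open>x' = f x\<close> whose vector field lives on \<open>U\<close>.\<close>
definition is_solution ::
  "('v::real_normed_vector \<Rightarrow> 'v) \<Rightarrow> 'v set \<Rightarrow> real \<Rightarrow> (real \<Rightarrow> 'v) \<Rightarrow> bool" where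
  "is_solution f U T \<phi> \<longleftrightarrow>
     (\<forall>t\<in>{0..<T}. \<phi> t \<in> U \<and> (\<phi> has_vector_derivative f (\<phi> t)) (at t within {0..<T}))"

text \<open>
  If \<open>X\<close> is closed, this implies that solutions starting in \<open>X\<close> never leave \<open>X\<close>: at the last time
  in \<open>X\<close> such a solution would be on the frontier, hence in the interior immediately afterwards.
\<close>
definition strictly_forward_invariant ::
  "('v::real_normed_vector \<Rightarrow> 'v) \<Rightarrow> 'v set \<Rightarrow> 'v set \<Rightarrow> bool" where
  "strictly_forward_invariant f U X \<longleftrightarrow>
     (\<forall>T \<phi>. is_solution f U T \<phi> \<and> \<phi> 0 \<in> frontier X \<longrightarrow> (\<forall>t\<in>{0<..<T}. \<phi> t \<in> interior X))"

end

theory Submission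
  imports Defs "HOL-Computational_Algebra.Fundamental_Theorem_Algebra"
begin

text \<open>
  The claim is pointwise linear algebra. In the symmetric part of the joint Jacobian the
  off-diagonal blocks \<open>G\<close> and \<open>-G'\<close> cancel (\<open>sym_part_skew_block\<close>), so it is the block diagonal
  matrix of the symmetric parts of the two systems, and its spectrum is the union, with
  multiplicities, of the two spectra. The two largest elements of the union come both from
  system \<open>a\<close>, or one from each system, or both from system \<open>b\<close>; their sum is then at most
  \<open>\<lambda>\<^sub>1\<^sup>a + \<lambda>\<^sub>2\<^sup>a\<close>, \<open>\<lambda>\<^sub>1\<^sup>a + \<lambda>\<^sub>1\<^sup>b\<close> or \<open>2 \<lambda>\<^sub>1\<^sup>b\<close>, and each of these is negative by one of the three
  hypotheses (\<open>two_largest_sum_neg_union\<close>).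

  Since eigenvalues are entries of the sorted list of roots of the characteristic polynomial, two
  facts about this polynomial support the argument. It is multiplicative on block diagonal matrices
  (\<open>charpoly_block_diagonal\<close>), which makes the multiset of roots a union. And for a symmetric matrix
  it has as many real roots as the dimension (\<open>size_proots_charpoly_symmetric\<close>), which guarantees
  that the lists are long enough for \<open>\<lambda>\<^sub>1\<close> and \<open>\<lambda>\<^sub>2\<close> to be genuine eigenvalues. The latter follows
  from the fundamental theorem of algebra, because all complex roots of the characteristic
  polynomial are real.
\<close>

section \<open>Characteristic polynomials of symmetric matrices\<close>

text \<open>
  The determinant is a polynomial with integer coefficients in the entries. This lets evaluation of
  polynomials, as a ring homomorphism, pass through \<^const>\<open>charpoly\<close>.
\<close>

lemma det_ring_hom:
  fixes h :: "'a::comm_ring_1 \<Rightarrow> 'b::comm_ring_1" and A :: "'a^'n^'n"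
  assumes one: "h 1 = 1"
    and add: "\<And>x y. h (x + y) = h x + h y"
    and mult: "\<And>x y. h (x * y) = h x * h y"
  shows "h (det A) = det (\<chi> i j. h (A $ i $ j))"
proof -
  have zero: "h 0 = 0"
    using add[of 0 0] by simp
  have minus: "h (- x) = - h x" for x
    using add[of x "- x"] zero by (simp add: eq_neg_iff_add_eq_0 add.commute)
  have sum: "h (\<Sum>x\<in>S. g x) = (\<Sum>x\<in>S. h (g x))" for S and g :: "('n \<Rightarrow> 'n) \<Rightarrow> 'a"
    by (induction S rule: infinite_finite_induct) (simp_all add: zero add)
  have prod: "h (\<Prod>x\<in>S. g x) = (\<Prod>x\<in>S. h (g x))" for S and g :: "'n \<Rightarrow> 'a"
    by (induction S rule: infinite_finite_induct) (simp_all add: one mult)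
  have sgn: "h (of_int (sign p) * x) = of_int (sign p) * h x" for p :: "'n \<Rightarrow> 'n" and x
    by (cases p rule: sign_cases) (simp_all add: minus)
  show ?thesis
    by (simp add: det_def sum sgn prod)
qed

lemma map_poly_of_real_mult:
  "map_poly of_real (p * q) = (map_poly of_real p * map_poly of_real q :: complex poly)"
  by (rule poly_eqI) (simp add: coeff_map_poly coeff_mult)

lemma poly_of_real_charpoly:
  fixes H :: "real^'k^'k"
  shows "poly (map_poly of_real (charpoly H)) (z::complex)
           = det (\<chi> i j. (if i = j then z else 0) - of_real (H $ i $ j))"
proof -
  define h :: "real poly \<Rightarrow> complex" where "h p = poly (map_poly of_real p) z" for p
  have mult: "h (p * q) = h p * h q" for p q
    by (simp add: h_def map_poly_of_real_mult)
  have "map_poly of_real (p + q) = (map_poly of_real p + map_poly of_real q :: complex poly)"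
    for p q :: "real poly"
    by (rule poly_eqI) (simp add: coeff_map_poly)
  hence add: "h (p + q) = h p + h q" for p q
    by (simp add: h_def)
  have entry: "h ((if i = j then [:0, 1:] else 0) - [:c:]) = (if i = j then z else 0) - of_real c"
    for i j :: 'k and c
    by (simp add: h_def map_poly_pCons)
  have "h (charpoly H) = det (\<chi> i j. h ((if i = j then [:0, 1:] else 0) - [:H $ i $ j:]))"
    unfolding charpoly_def
    by (subst det_ring_hom[where h = h]) (simp_all add: add mult, simp add: h_def)
  thus ?thesis
    by (simp only: entry) (simp add: h_def)
qed

text \<open>
  In the Leibniz expansion the identity contributes the product of the \<open>n\<close> monic linear diagonal
  entries. Any other permutation picks a constant off-diagonal entry, so that its product has
  smaller degree and cannot cancel the leading term.
\<close>

lemma degree_charpoly: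
  fixes H :: "real^'k^'k"
  shows "degree (charpoly H) = CARD('k)"
proof -
  define M :: "real poly^'k^'k" where "M = (\<chi> i j. (if i = j then [:0, 1:] else 0) - [:H $ i $ j:])"
  define P where "P = {p::'k \<Rightarrow> 'k. p permutes UNIV}"
  define t where "t p = of_int (sign p) * (\<Prod>i\<in>UNIV. M $ i $ p i)" for p
  have fin: "finite P"
    unfolding P_def by (simp add: finite_permutations)
  have idP: "id \<in> P"
    by (simp add: P_def permutes_id)
  have diag: "degree (M $ i $ i) = 1" "lead_coeff (M $ i $ i) = 1" for i
    by (simp_all add: M_def)
  have off: "degree (M $ i $ j) = (if i = j then 1 else 0)" for i j
    by (simp add: M_def)
  have deg_id: "degree (t id) = CARD('k)"
  proof -
    have "M $ i $ i \<noteq> 0" for i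
      using diag(1)[of i] by auto
    hence "degree (\<Prod>i\<in>UNIV. M $ i $ i) = (\<Sum>i\<in>(UNIV :: 'k set). degree (M $ i $ i))"
      by (intro degree_prod_eq_sum_degree) auto
    thus ?thesis
      by (simp add: t_def diag)
  qed
  have deg_lt: "degree (t p) < CARD('k)" if p: "p \<in> P - {id}" for p
  proof -
    obtain i where i: "p i \<noteq> i"
      using p by (auto simp: fun_eq_iff)
    have "degree (t p) = degree (\<Prod>i\<in>UNIV. M $ i $ p i)"
      by (cases p rule: sign_cases) (simp_all add: t_def)
    also have "\<dots> \<le> (\<Sum>i\<in>UNIV. degree (M $ i $ p i))"
      using degree_prod_sum_le[of UNIV "\<lambda>i. M $ i $ p i"] by (simp add: o_def)
    also have "\<dots> < (\<Sum>i\<in>(UNIV :: 'k set). 1)"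
    proof (rule sum_strict_mono_ex1)
      show "\<exists>i\<in>UNIV. degree (M $ i $ p i) < 1"
        using i by (intro bexI[of _ i]) (simp_all add: off)
    qed (simp_all add: off)
    finally show ?thesis by simp
  qed
  have "charpoly H = t id + (\<Sum>p\<in>P - {id}. t p)"
    unfolding charpoly_def M_def[symmetric] det_def t_def[symmetric] P_def[symmetric]
    using fin idP by (simp add: sum.remove)
  moreover have "degree (\<Sum>p\<in>P - {id}. t p) < CARD('k)"
    by (rule degree_sum_less) (use deg_lt in auto)
  ultimately show ?thesis
    by (simp add: degree_add_eq_left deg_id)
qed

text \<open>
  For an eigenvector \<open>v\<close> of the root \<open>z\<close>, the Hermitian form \<open>v\<^sup>* H v\<close> equals \<open>z \<parallel>v\<parallel>\<^sup>2\<close>. It is its own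
  conjugate because \<open>H\<close> is real and symmetric, and \<open>\<parallel>v\<parallel>\<^sup>2\<close> is a positive real, so \<open>z\<close> is real.
\<close>

lemma complex_eigenvalue_of_symmetric_real:
  fixes H :: "real^'k^'k"
    and z :: complex
  assumes sym: "transpose H = H"
    and root: "poly (map_poly of_real (charpoly H)) z = 0"
  shows "z \<in> \<real>"
proof -
  define B :: "complex^'k^'k" where "B = (\<chi> i j. (if i = j then z else 0) - of_real (H $ i $ j))"
  have "det B = 0"
    using root by (simp add: B_def poly_of_real_charpoly)
  then obtain v where v: "B *v v = 0" "v \<noteq> 0"
    using invertible_det_nz[of B] matrix_left_invertible_ker[of B] invertible_left_inverse[of B]
    by blast
  have eig: "(\<Sum>j\<in>UNIV. of_real (H $ i $ j) * v $ j) = z * v $ i" for i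
  proof -
    have "0 = (B *v v) $ i"
      by (simp add: v)
    also have "\<dots> = (\<Sum>j\<in>UNIV. (if i = j then z * v $ j else 0) - of_real (H $ i $ j) * v $ j)"
      unfolding matrix_vector_mult_def B_def
      by (auto simp: left_diff_distrib intro!: sum.cong)
    also have "\<dots> = z * v $ i - (\<Sum>j\<in>UNIV. of_real (H $ i $ j) * v $ j)"
      by (simp add: sum_subtractf)
    finally show ?thesis by simp
  qed
  define q where "q = (\<Sum>i\<in>UNIV. \<Sum>j\<in>UNIV. cnj (v $ i) * of_real (H $ i $ j) * v $ j)"
  define s where "s = (\<Sum>i\<in>UNIV. (cmod (v $ i))\<^sup>2)"
  have Hsym: "H $ i $ j = H $ j $ i" for i j
    using arg_cong[OF sym, of "\<lambda>M. M $ j $ i"] by (simp add: transpose_def)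
  have "cnj q = (\<Sum>i\<in>UNIV. \<Sum>j\<in>UNIV. v $ i * of_real (H $ i $ j) * cnj (v $ j))"
    by (simp add: q_def)
  also have "\<dots> = (\<Sum>j\<in>UNIV. \<Sum>i\<in>UNIV. v $ i * of_real (H $ i $ j) * cnj (v $ j))"
    by (rule sum.swap)
  also have "\<dots> = q"
    unfolding q_def by (intro sum.cong refl) (simp add: Hsym mult_ac)
  finally have q_real: "q \<in> \<real>"
    by (simp add: Reals_cnj_iff)
  have "q = (\<Sum>i\<in>UNIV. cnj (v $ i) * (\<Sum>j\<in>UNIV. of_real (H $ i $ j) * v $ j))"
    by (simp add: q_def sum_distrib_left mult.assoc)
  also have "\<dots> = (\<Sum>i\<in>UNIV. z * of_real ((cmod (v $ i))\<^sup>2))"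
    unfolding eig complex_norm_square by (simp add: mult_ac)
  also have "\<dots> = z * of_real s"
    by (simp add: s_def sum_distrib_left)
  finally have q_eq: "q = z * of_real s" .
  obtain i where "v $ i \<noteq> 0"
    using v(2) by (auto simp: vec_eq_iff)
  hence "s > 0"
    unfolding s_def by (intro sum_pos2[of UNIV i]) auto
  hence "z = q / of_real s"
    by (simp add: q_eq)
  thus ?thesis
    using q_real by simp
qed

text \<open>
  The fundamental theorem of algebra yields a complex root, which is real by assumption; splitting
  off the corresponding real linear factor lowers the degree by one.
\<close>

lemma size_proots_eq_degree_if_roots_real:
  fixes p :: "real poly"
  assumes "p \<noteq> 0" "\<And>z::complex. poly (map_poly of_real p) z = 0 \<Longrightarrow> z \<in> \<real>"
  shows "size (proots p) = degree p"
  using assms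
proof (induction "degree p" arbitrary: p)
  case 0
  then obtain c where "p = [:c:]"
    by (metis degree_eq_zeroE)
  thus ?case by simp
next
  case (Suc n)
  have "degree (map_poly complex_of_real p) = Suc n"
    using Suc.hyps by (simp add: degree_map_poly)
  then obtain z :: complex where z: "poly (map_poly of_real p) z = 0"
    using alg_closed_imp_poly_has_root[of "map_poly complex_of_real p"] by auto
  with Suc.prems obtain a where a: "z = of_real a"
    by (auto elim: Reals_cases)
  have "poly (map_poly of_real r) (complex_of_real a) = of_real (poly r a)" for r :: "real poly"
    by (induction r) (auto simp: map_poly_pCons)
  with z have "poly p a = 0"
    by (simp add: a)
  then obtain q where q: "p = [:- a, 1:] * q"
    by (auto simp: poly_eq_0_iff_dvd)
  with Suc.prems(1) have "q \<noteq> 0" by auto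
  have "degree p = Suc (degree q)"
    unfolding q by (subst degree_mult_eq) (use \<open>q \<noteq> 0\<close> in auto)
  moreover have "size (proots q) = degree q"
  proof (rule Suc.hyps)
    show "n = degree q"
      using \<open>degree p = Suc (degree q)\<close> Suc.hyps by simp
    show "z \<in> \<real>" if "poly (map_poly of_real q) z = 0" for z :: complex
      using that Suc.prems(2)[of z] unfolding q map_poly_of_real_mult by simp
  qed fact
  moreover have "proots p = {#a#} + proots q"
    unfolding q using \<open>q \<noteq> 0\<close> by (subst proots_mult) auto
  ultimately show ?case by simp
qed

lemma size_proots_charpoly_symmetric:
  fixes H :: "real^'k^'k"
  assumes "transpose H = H"
  shows "size (proots (charpoly H)) = CARD('k)"
proof -
  have "charpoly H \<noteq> 0"
    using degree_charpoly[of H] by auto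
  thus ?thesis
    using size_proots_eq_degree_if_roots_real complex_eigenvalue_of_symmetric_real[OF assms]
      degree_charpoly[of H] by metis
qed

section \<open>Block diagonal matrices\<close>

text \<open>
  The permutation acting on both summands is the composition of its actions on one summand at a
  time, and each of those is a product of as many transpositions as the original permutation.
\<close>

lemma sign_map_sum:
  fixes p :: "'n::finite \<Rightarrow> 'n" and q :: "'m::finite \<Rightarrow> 'm"
  assumes p: "p permutes UNIV" and q: "q permutes UNIV"
  shows "sign (map_sum p q) = sign p * sign q"
proof -
  have perm: "permutation (map_sum f g)" if "bij f" "bij g"
    for f :: "'n \<Rightarrow> 'n" and g :: "'m \<Rightarrow> 'm"
  proof -
    have "inj (map_sum f g)"
      using that by (intro sum.inj_map) (auto simp: bij_def)
    thus ?thesis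
      by (simp add: permutation finite_UNIV_inj_surj bij_def)
  qed
  have bij: "bij p" "bij q"
    using p q by (auto intro: permutes_bij)
  have left: "sign (map_sum p (id :: 'm \<Rightarrow> 'm)) = sign p"
    using p finite
  proof (induction p rule: permutes_induct)
    case id
    show ?case unfolding sum.map_id0 by simp
  next
    case (swap a b p)
    have "map_sum (Transposition.transpose a b \<circ> p) (id :: 'm \<Rightarrow> 'm)
            = Transposition.transpose (Inl a) (Inl b) \<circ> map_sum p id"
    proof
      fix r :: "'n + 'm"
      show "map_sum (Transposition.transpose a b \<circ> p) id r
              = (Transposition.transpose (Inl a) (Inl b) \<circ> map_sum p id) r"
        by (cases r) (auto simp: Transposition.transpose_def)
    qed
    moreover have "permutation p" "permutation (map_sum p (id :: 'm \<Rightarrow> 'm))"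
      using permutes_bij[OF \<open>p permutes UNIV\<close>]
      by (simp_all add: permutation perm[unfolded permutation])
    ultimately show ?case
      using swap by (simp only: sign_compose permutation_swap_id sign_swap_id sum.inject)
  qed
  have right: "sign (map_sum (id :: 'n \<Rightarrow> 'n) q) = sign q"
    using q finite
  proof (induction q rule: permutes_induct)
    case id
    show ?case unfolding sum.map_id0 by simp
  next
    case (swap a b p)
    have "map_sum (id :: 'n \<Rightarrow> 'n) (Transposition.transpose a b \<circ> p)
            = Transposition.transpose (Inr a) (Inr b) \<circ> map_sum id p"
    proof
      fix r :: "'n + 'm"
      show "map_sum id (Transposition.transpose a b \<circ> p) r
              = (Transposition.transpose (Inr a) (Inr b) \<circ> map_sum id p) r"
        by (cases r) (auto simp: Transposition.transpose_def)
    qed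
    moreover have "permutation p" "permutation (map_sum (id :: 'n \<Rightarrow> 'n) p)"
      using permutes_bij[OF \<open>p permutes UNIV\<close>]
      by (simp_all add: permutation perm[unfolded permutation])
    ultimately show ?case
      using swap by (simp only: sign_compose permutation_swap_id sign_swap_id sum.inject)
  qed
  have "map_sum p q = map_sum p id \<circ> map_sum id q"
    by (simp add: sum.map_comp fun_eq_iff)
  thus ?thesis
    using bij by (simp add: sign_compose perm left right)
qed

text \<open>
  A permutation that sends some index of one block into the other block meets a zero entry, so the
  Leibniz sum reduces to the permutations \<^term>\<open>map_sum p q\<close> that preserve both blocks; these
  range over pairs, and their terms are products.
\<close>

lemma det_block_diagonal:
  fixes A :: "'a::comm_ring_1^'n^'n" and D :: "'a^'m^'m"
    and M :: "'a^('n::finite + 'm::finite)^('n + 'm)"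
  assumes M: "\<And>i k. M $ Inl i $ Inl k = A $ i $ k" "\<And>i l. M $ Inl i $ Inr l = 0"
    "\<And>j k. M $ Inr j $ Inl k = 0" "\<And>j l. M $ Inr j $ Inr l = D $ j $ l"
  shows "det M = det A * det D"
proof -
  define Pn where "Pn = {p::'n \<Rightarrow> 'n. p permutes UNIV}"
  define Pm where "Pm = {q::'m \<Rightarrow> 'm. q permutes UNIV}"
  define P where "P = {r::'n + 'm \<Rightarrow> 'n + 'm. r permutes UNIV}"
  define t where "t r = of_int (sign r) * (\<Prod>x\<in>UNIV. M $ x $ r x)" for r
  define g where "g = (\<lambda>(p :: 'n \<Rightarrow> 'n, q :: 'm \<Rightarrow> 'm). map_sum p q)"
  have permutesI: "f permutes UNIV" if "inj f" for f :: "'c::finite \<Rightarrow> 'c"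
    using that by (intro bij_imp_permutes) (auto simp: bij_def finite_UNIV_inj_surj)
  have inj_g: "inj g"
  proof (rule injI, clarify)
    fix p p' q q' assume eq: "g (p, q) = g (p', q')"
    have "p i = p' i" for i
      using fun_cong[OF eq, of "Inl i"] by (simp add: g_def)
    moreover have "q j = q' j" for j
      using fun_cong[OF eq, of "Inr j"] by (simp add: g_def)
    ultimately show "p = p' \<and> q = q'" by auto
  qed
  have sub: "g ` (Pn \<times> Pm) \<subseteq> P"
  proof clarify
    fix p q assume "p \<in> Pn" "q \<in> Pm"
    hence "inj (map_sum p q)"
      by (intro sum.inj_map) (auto simp: Pn_def Pm_def permutes_inj)
    thus "g (p, q) \<in> P"
      by (simp add: g_def P_def permutesI)
  qed
  (* A nonzero term forces r to preserve both blocks, and then r splits as map_sum p q. *)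
  have zero: "t r = 0" if r: "r \<in> P - g ` (Pn \<times> Pm)" for r
  proof (rule ccontr)
    assume "t r \<noteq> 0"
    have nz: "M $ x $ r x \<noteq> 0" for x
    proof
      assume "M $ x $ r x = 0"
      hence "(\<Prod>x\<in>UNIV. M $ x $ r x) = 0"
        by (intro prod_zero) auto
      with \<open>t r \<noteq> 0\<close> show False
        by (simp add: t_def)
    qed
    have "\<exists>k. r (Inl i) = Inl k" for i
      using nz[of "Inl i"] M by (cases "r (Inl i)") auto
    then obtain p where p: "\<And>i. r (Inl i) = Inl (p i)" by metis
    have "\<exists>k. r (Inr j) = Inr k" for j
      using nz[of "Inr j"] M by (cases "r (Inr j)") auto
    then obtain q where q: "\<And>j. r (Inr j) = Inr (q j)" by metis
    have "inj r"
      using r unfolding P_def by (blast intro: permutes_inj)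
    have "inj p"
      using \<open>inj r\<close> p by (intro injI) (metis injD sum.inject(1))
    moreover have "inj q"
      using \<open>inj r\<close> q by (intro injI) (metis injD sum.inject(2))
    moreover have "r = g (p, q)"
    proof
      fix x show "r x = g (p, q) x"
        by (cases x) (simp_all add: g_def p q)
    qed
    ultimately show False
      using r by (auto simp: Pn_def Pm_def permutesI)
  qed
  have split: "t (g (p, q)) = (of_int (sign p) * (\<Prod>i\<in>UNIV. A $ i $ p i))
                 * (of_int (sign q) * (\<Prod>j\<in>UNIV. D $ j $ q j))"
    if "p \<in> Pn" "q \<in> Pm" for p q
  proof -
    have "(\<Prod>x\<in>UNIV. M $ x $ map_sum p q x)
            = (\<Prod>i\<in>UNIV. A $ i $ p i) * (\<Prod>j\<in>UNIV. D $ j $ q j)"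
      by (subst UNIV_sum, subst prod.union_disjoint)
         (auto simp: prod.reindex M)
    thus ?thesis
      using that by (simp add: t_def g_def Pn_def Pm_def sign_map_sum mult_ac)
  qed
  have "det M = (\<Sum>r\<in>P. t r)"
    by (simp add: det_def t_def P_def)
  also have "\<dots> = (\<Sum>r\<in>g ` (Pn \<times> Pm). t r)"
    by (rule sum.mono_neutral_right) (use sub zero in \<open>auto simp: P_def finite_permutations\<close>)
  also have "\<dots> = (\<Sum>x\<in>Pn \<times> Pm. t (g x))"
    using inj_g by (subst sum.reindex) (auto intro: inj_on_subset)
  also have "\<dots> = (\<Sum>p\<in>Pn. \<Sum>q\<in>Pm. t (g (p, q)))"
    by (simp add: sum.cartesian_product)
  also have "\<dots> = det A * det D"
    by (simp add: split det_def Pn_def[symmetric] Pm_def[symmetric] sum_product)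
  finally show ?thesis .
qed

lemma charpoly_block_diagonal:
  fixes A :: "real^'n^'n" and D :: "real^'m^'m"
  shows "charpoly (block_matrix A 0 0 D) = charpoly A * charpoly D"
  unfolding charpoly_def
  by (rule det_block_diagonal) (simp_all add: block_matrix_def)

lemma transpose_sym_part: "transpose (sym_part J) = sym_part J"
  by (simp add: sym_part_def transpose_def vec_eq_iff add.commute)

lemma sym_part_skew_block:
  "sym_part (block_matrix A G (- transpose G) D) = block_matrix (sym_part A) 0 0 (sym_part D)"
  unfolding vec_eq_iff
proof (intro allI)
  fix r c
  show "sym_part (block_matrix A G (- transpose G) D) $ r $ c
          = block_matrix (sym_part A) 0 0 (sym_part D) $ r $ c"
    by (cases r; cases c) (simp_all add: sym_part_def block_matrix_def transpose_def)
qed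

section \<open>The two largest elements of a union of multisets\<close>

text \<open>
  The first two entries of the decreasing list, described without lists: removing one copy of the
  first leaves a multiset \<open>N\<close> whose maximum is the second. Keeping \<open>N\<close> explicit accounts for a
  maximum that occurs several times.
\<close>

lemma largest_elements:
  fixes M :: "'a::linorder multiset"
  assumes "M \<noteq> {#}"
  defines "l \<equiv> rev (sorted_list_of_multiset M)"
  obtains N where "M = add_mset (l ! 0) N" "\<And>x. x \<in># M \<Longrightarrow> x \<le> l ! 0"
    "size M \<ge> 2 \<Longrightarrow> l ! 1 \<in># N" "\<And>x. x \<in># N \<Longrightarrow> x \<le> l ! 1"
proof -
  have mset: "mset l = M"
    by (simp add: l_def)
  have desc: "sorted_wrt (\<ge>) l"
    unfolding l_def sorted_wrt_rev by simp
  obtain a as where l: "l = a # as"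
    using assms(1) mset by (cases l) auto
  show ?thesis
  proof (rule that[of "mset as"])
    show "M = add_mset (l ! 0) (mset as)"
      using mset l by simp
    show "x \<le> l ! 0" if "x \<in># M" for x
      using that desc mset[symmetric] l by auto
    show "l ! 1 \<in># mset as" if "size M \<ge> 2"
      using that mset[symmetric] l by (cases as) auto
    show "x \<le> l ! 1" if "x \<in># mset as" for x
      using that desc l by (cases as) auto
  qed
qed

text \<open>
  The case distinction on the origin of the two largest elements of the union. Both sizes are
  bounded below so that the entries occurring in the hypotheses exist.
\<close>

lemma two_largest_sum_neg_union:
  fixes A B :: "real multiset"
  defines "ranked \<equiv> \<lambda>i M. rev (sorted_list_of_multiset M) ! i"
  assumes sizes: "size A \<ge> 2" "size B \<ge> 1"
    and AA: "ranked 0 A + ranked 1 A < 0" and BB: "ranked 0 B < 0" and AB: "ranked 0 A + ranked 0 B < 0"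
  shows "ranked 0 (A + B) + ranked 1 (A + B) < 0"
proof -
  have ne: "A \<noteq> {#}" "B \<noteq> {#}" "A + B \<noteq> {#}"
    using sizes by auto
  obtain A' where A: "A = add_mset (ranked 0 A) A'" "\<And>x. x \<in># A \<Longrightarrow> x \<le> ranked 0 A"
      "\<And>x. x \<in># A' \<Longrightarrow> x \<le> ranked 1 A"
    using largest_elements[OF ne(1)] unfolding ranked_def by metis
  have B: "x \<le> ranked 0 B" if "x \<in># B" for x
    using largest_elements[OF ne(2)] that unfolding ranked_def by metis
  define x where "x = ranked 0 (A + B)"
  define y where "y = ranked 1 (A + B)"
  obtain N where N: "A + B = add_mset x N" "y \<in># N"
  proof (rule largest_elements[OF ne(3)])
    fix N
    assume "A + B = add_mset (rev (sorted_list_of_multiset (A + B)) ! 0) N"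
      "2 \<le> size (A + B) \<Longrightarrow> rev (sorted_list_of_multiset (A + B)) ! 1 \<in># N"
    thus thesis
      using that[of N] sizes by (simp add: x_def y_def ranked_def)
  qed
  (* A pair taken from A with multiplicity cannot use the maximum of A more often than it occurs. *)
  have within_A: "u + v < 0" if "u \<in># A" "v \<in># A - {#u#}" for u v
  proof (cases "u = ranked 0 A")
    case True
    hence "v \<in># A'"
      using that(2) A(1) by (metis add_mset_remove_trivial)
    thus ?thesis
      using True A(3)[of v] AA by simp
  next
    case False
    hence "u \<in># A'"
      using that(1) A(1) by (metis insert_iff set_mset_add_mset_insert)
    moreover have "v \<in># A"
      using that(2) by (rule in_diffD)
    ultimately show ?thesis
      using A(2)[of v] A(3)[of u] AA by simp
  qed
  have xy: "x \<in># A + B" "y \<in># A + B - {#x#}"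
    using N by auto
  show ?thesis
    unfolding x_def[symmetric] y_def[symmetric]
  proof (cases "x \<in># A")
    case True
    hence "A + B - {#x#} = A - {#x#} + B"
      by (metis add_mset_remove_trivial insert_DiffM union_mset_add_mset_left)
    hence "y \<in># A - {#x#} \<or> y \<in># B"
      using xy(2) by (metis union_iff)
    thus "x + y < 0"
      using within_A[OF True] A(2)[OF True] B[of y] AB by fastforce
  next
    case False
    hence "x \<in># B" "y \<in># A + (B - {#x#})"
      using xy by auto
    hence "y \<in># A \<or> y \<in># B"
      by (auto dest: in_diffD)
    thus "x + y < 0"
      using B[OF \<open>x \<in># B\<close>] A(2)[of y] B[of y] AB BB by fastforce
  qed
qed

section \<open>Skew-symmetric feedback\<close>

theorem theorem2:
  fixes fa :: "real^'n \<Rightarrow> real^'m \<Rightarrow> real^'n"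
    and fb :: "real^'m \<Rightarrow> real^'n \<Rightarrow> real^'m"
    and f :: "real^('n::finite + 'm::finite) \<Rightarrow> real^('n::finite + 'm::finite)"
    and U X :: "(real^('n::finite + 'm::finite)) set"
    and Ja :: "real^('n::finite + 'm::finite) \<Rightarrow> real^'n^'n"
    and Jb :: "real^('n::finite + 'm::finite) \<Rightarrow> real^'m^'m"
    and G :: "real^('n::finite + 'm::finite) \<Rightarrow> real^'m^'n"
    and Jab :: "real^('n::finite + 'm::finite) \<Rightarrow> real^('n::finite + 'm::finite)^('n + 'm)"
  assumes "CARD('n) \<ge> 2" and "CARD('m) \<ge> 1"
    and "f = interconnection fa fb"
    and "open U" and "X \<subseteq> U"
    and "compact X" and "simply_connected X" and "strictly_forward_invariant f U X"
    and "\<forall>x\<in>X. f differentiable (at x)"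
    and "\<forall>x\<in>X. Ja x = state_jacobian fa (state_a x) (state_b x)"
    and "\<forall>x\<in>X. Jb x = state_jacobian fb (state_b x) (state_a x)"
    and "\<forall>x\<in>X. Jab x = jacobian f (at x)"
    and "\<forall>x\<in>X. Jab x = block_matrix (Ja x) (G x) (- transpose (G x)) (Jb x)"
    and "weakly_contracting_on X Ja"
    and "contracting_on X Jb"
    and "\<forall>x\<in>X. eigval 1 (sym_part (Ja x)) + eigval 1 (sym_part (Jb x)) < 0"
  shows "weakly_contracting_on X Jab"
  unfolding weakly_contracting_on_def
proof
  fix x assume x: "x \<in> X"
  let ?A = "sym_part (Ja x)" and ?B = "sym_part (Jb x)"
  have H: "sym_part (Jab x) = block_matrix ?A 0 0 ?B"
    using assms(13) x by (simp add: sym_part_skew_block)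
  have size: "size (proots (charpoly ?A)) = CARD('n)" "size (proots (charpoly ?B)) = CARD('m)"
    by (simp_all add: size_proots_charpoly_symmetric transpose_sym_part)
  have "charpoly ?A \<noteq> 0" "charpoly ?B \<noteq> 0"
    using degree_charpoly[of ?A] degree_charpoly[of ?B] by auto
  hence "proots (charpoly (sym_part (Jab x))) = proots (charpoly ?A) + proots (charpoly ?B)"
    unfolding H charpoly_block_diagonal by (intro proots_mult) auto
  moreover have "eigval 1 ?A + eigval 2 ?A < 0" "eigval 1 ?B < 0" "eigval 1 ?A + eigval 1 ?B < 0"
    using assms(14,15,16) x by (auto simp: weakly_contracting_on_def contracting_on_def)
  ultimately show "eigval 1 (sym_part (Jab x)) + eigval 2 (sym_part (Jab x)) < 0"
    using two_largest_sum_neg_union[of "proots (charpoly ?A)" "proots (charpoly ?B)"]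
      size assms(1,2) by (simp add: eigval_def)
qed

end
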